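(* Let $(G,\omega)$ be a weighted graph with $n$ vertices and total weight $N=\sum_{v\in V(G)}\omega(v)$. Then $\tau_{(G,\omega)}=(x-1)^{N-n}\tau_G$, where $\tau_G$ is the tree polynomial of the underlying unweighted graph $G$; moreover $\tau_G(1)\ne0$, so the largest integer $k$ with $(x-1)^k\mid\tau_{(G,\omega)}$ is $k=N-n$ (the excess weight).
   Context: A weighted graph $(G,\omega)$ is a finite simple graph with $\omega:V(G)\to\{1,2,\dots\}$, and $X_{(G,\omega)}=\sum_\kappa\prod_{v}x_{\kappa(v)}^{\omega(v)}$ over proper colourings $\kappa:V(G)\to\{1,2,\dots\}$; the unweighted $X_G$ is the case $\omega\equiv1$. $P_\lambda$ is the disjoint union of paths with $\lambda_1,\dots,\lambda_{\ell(\lambda)}$ vertices; $\{X_{P_\lambda}\}$ is a basis of the symmetric functions over $\mathbb{Q}$. For $f=\sum_\lambda a_\lambda X_{P_\lambda}$, $\tau_f(x)=\sum_\lambda a_\lambda x^{\ell(\lambda)}$; $\tau_{(G,\omega)}=\tau_{X_{(G,\omega)}}$ and $\tau_G=\tau_{X_G}$. *)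

theory Defs
  imports "HOL-Library.FuncSet" "HOL-Computational_Algebra.Polynomial"
begin

text \<open>A symmetric function (a formal power series in variables x_0, x_1, ...)
  is represented by its coefficient function: exponent vectors
  alpha :: nat => nat (finitely supported) to rationals.\<close>

type_synonym sym_fun = "(nat \<Rightarrow> nat) \<Rightarrow> rat"

definition proper_colouring :: "'v set \<Rightarrow> ('v \<Rightarrow> 'v \<Rightarrow> bool) \<Rightarrow> ('v \<Rightarrow> nat) \<Rightarrow> bool" where
  "proper_colouring V E \<kappa> \<longleftrightarrow> (\<forall>u\<in>V. \<forall>v\<in>V. E u v \<longrightarrow> \<kappa> u \<noteq> \<kappa> v)"

definition chrom_sym :: "'v set \<Rightarrow> ('v \<Rightarrow> 'v \<Rightarrow> bool) \<Rightarrow> ('v \<Rightarrow> nat) \<Rightarrow> sym_fun" where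
  "chrom_sym V E \<omega> \<alpha> = of_nat (card {\<kappa> \<in> V \<rightarrow>\<^sub>E (UNIV :: nat set).
       proper_colouring V E \<kappa> \<and> (\<forall>i. (\<Sum>v\<in>{v\<in>V. \<kappa> v = i}. \<omega> v) = \<alpha> i)})"

definition simple_graph :: "'v set \<Rightarrow> ('v \<Rightarrow> 'v \<Rightarrow> bool) \<Rightarrow> bool" where
  "simple_graph V E \<longleftrightarrow> finite V \<and> (\<forall>u v. E u v \<longrightarrow> u \<in> V \<and> v \<in> V)
     \<and> (\<forall>u v. E u v \<longrightarrow> E v u) \<and> (\<forall>v. \<not> E v v)"

definition partitions :: "nat list set" where
  "partitions = {ls. sorted (rev ls) \<and> (\<forall>x\<in>set ls. 0 < x)}"

definition path_verts :: "nat list \<Rightarrow> (nat \<times> nat) set" where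
  "path_verts ls = {(i, j). i < length ls \<and> j < ls ! i}"

definition path_edge :: "nat list \<Rightarrow> nat \<times> nat \<Rightarrow> nat \<times> nat \<Rightarrow> bool" where
  "path_edge ls p q \<longleftrightarrow> p \<in> path_verts ls \<and> q \<in> path_verts ls \<and> fst p = fst q
     \<and> (snd q = Suc (snd p) \<or> snd p = Suc (snd q))"

definition X_path :: "nat list \<Rightarrow> sym_fun" where
  "X_path ls = chrom_sym (path_verts ls) (path_edge ls) (\<lambda>_. 1)"

definition path_expansion :: "sym_fun \<Rightarrow> (nat list \<Rightarrow> rat) \<Rightarrow> bool" where
  "path_expansion f a \<longleftrightarrow> finite {ls. a ls \<noteq> 0} \<and> {ls. a ls \<noteq> 0} \<subseteq> partitions
     \<and> (\<forall>\<alpha>. f \<alpha> = (\<Sum>ls\<in>{ls. a ls \<noteq> 0}. a ls * X_path ls \<alpha>))"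

definition tau :: "sym_fun \<Rightarrow> rat poly" where
  "tau f = (THE p. \<exists>a. path_expansion f a \<and>
             p = (\<Sum>ls\<in>{ls. a ls \<noteq> 0}. monom (a ls) (length ls)))"

end

theory Submission
  imports Defs "HOL-Combinatorics.List_Permutation"
begin

text \<open>Linearity, multiplicativity and \<open>X\<^bsub>P\<^sub>k\<^esub> \<mapsto> x\<close> make the tree polynomial a ring homomorphism.
  At \<open>x = M / (M - 1)\<close> it is the evaluation of a symmetric function at \<open>M\<close> copies of
  \<open>1 / (M - 1)\<close>, because a path with \<open>k\<close> vertices has \<open>M (M - 1)\<^bsup>k-1\<^esup>\<close> proper \<open>M\<close>-colourings;
  these infinitely many points show that the tree polynomial does not depend on the path expansion.

  Existence comes from deletion-contraction. Contracting an edge keeps the total weight and loses a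
  vertex, so it raises the excess by one: if \<open>q\<^sub>1\<close> and \<open>q\<^sub>2\<close> belong to the deletion and the contraction,
  then \<open>q\<^sub>1 - (x - 1) q\<^sub>2\<close> belongs to the graph, with the same value 1 at \<open>x = 1\<close>. For edgeless
  graphs, the relation is read backwards to split heavy vertices.\<close>

section \<open>Weighted colourings\<close>

definition colourings :: "'v set \<Rightarrow> ('v \<Rightarrow> 'v \<Rightarrow> bool) \<Rightarrow> ('v \<Rightarrow> nat) \<Rightarrow> (nat \<Rightarrow> nat) \<Rightarrow> ('v \<Rightarrow> nat) set"
  where "colourings V E \<omega> \<alpha> = {\<kappa> \<in> V \<rightarrow>\<^sub>E (UNIV :: nat set).
       proper_colouring V E \<kappa> \<and> (\<forall>i. (\<Sum>v\<in>{v\<in>V. \<kappa> v = i}. \<omega> v) = \<alpha> i)}"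

lemma chrom_sym_colourings: "chrom_sym V E \<omega> \<alpha> = of_nat (card (colourings V E \<omega> \<alpha>))"
  by (simp add: chrom_sym_def colourings_def)

lemma colourings_weight_pos:
  assumes "finite V" "\<forall>v\<in>V. 1 \<le> \<omega> v" "\<kappa> \<in> colourings V E \<omega> \<alpha>" "v \<in> V"
  shows "\<alpha> (\<kappa> v) \<noteq> 0"
proof -
  have "\<alpha> (\<kappa> v) = (\<Sum>u\<in>{u\<in>V. \<kappa> u = \<kappa> v}. \<omega> u)"
    using assms by (simp add: colourings_def)
  moreover have "\<omega> v \<le> (\<Sum>u\<in>{u\<in>V. \<kappa> u = \<kappa> v}. \<omega> u)"
    using assms by (intro member_le_sum) auto
  ultimately show ?thesis using assms by fastforce
qed

lemma colourings_weight_support: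
  assumes "\<kappa> \<in> colourings V E \<omega> \<alpha>" "\<alpha> i \<noteq> 0"
  shows "i \<in> \<kappa> ` V"
proof (rule ccontr)
  assume "i \<notin> \<kappa> ` V"
  then have empty: "{v\<in>V. \<kappa> v = i} = {}" by auto
  have "(\<Sum>v\<in>{v\<in>V. \<kappa> v = i}. \<omega> v) = \<alpha> i"
    using assms by (simp add: colourings_def)
  then show False using assms(2) unfolding empty by simp
qed

text \<open>Positive weights make the colours in use exactly the support of \<open>\<alpha>\<close>,
  so a single colouring already bounds that support. Finiteness lets the cardinalities add in
  deletion-contraction, as \<open>card\<close> is 0 on infinite sets.\<close>

lemma finite_colourings:
  assumes "finite V" "\<forall>v\<in>V. 1 \<le> \<omega> v"
  shows "finite (colourings V E \<omega> \<alpha>)"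
proof (cases "colourings V E \<omega> \<alpha> = {}")
  case False
  then obtain \<kappa>0 where k: "\<kappa>0 \<in> colourings V E \<omega> \<alpha>" by blast
  then have "{i. \<alpha> i \<noteq> 0} \<subseteq> \<kappa>0 ` V"
    using colourings_weight_support by fast
  then have "finite {i. \<alpha> i \<noteq> 0}"
    using assms(1) finite_subset by blast
  then have "finite (V \<rightarrow>\<^sub>E {i. \<alpha> i \<noteq> 0})"
    using assms(1) by (intro finite_PiE) auto
  moreover have "colourings V E \<omega> \<alpha> \<subseteq> V \<rightarrow>\<^sub>E {i. \<alpha> i \<noteq> 0}"
  proof
    fix \<kappa> assume k: "\<kappa> \<in> colourings V E \<omega> \<alpha>"
    then have "\<kappa> \<in> extensional V" by (simp add: colourings_def PiE_iff)
    then show "\<kappa> \<in> V \<rightarrow>\<^sub>E {i. \<alpha> i \<noteq> 0}"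
      using colourings_weight_pos[OF assms k] by (simp add: PiE_iff)
  qed
  ultimately show ?thesis using finite_subset by blast
qed simp

lemma chrom_sym_iso:
  assumes bij: "bij_betw f V W"
    and edge: "\<And>a b. a \<in> V \<Longrightarrow> b \<in> V \<Longrightarrow> E a b \<longleftrightarrow> F (f a) (f b)"
    and weight: "\<And>a. a \<in> V \<Longrightarrow> \<omega> a = \<eta> (f a)"
  shows "chrom_sym V E \<omega> = chrom_sym W F \<eta>"
proof
  fix \<alpha>
  define g where "g = inv_into V f"
  have bijg: "bij_betw g W V" using bij by (simp add: g_def bij_betw_inv_into)
  have gf: "g (f a) = a" if "a \<in> V" for a
    using bij that by (simp add: g_def bij_betw_inv_into_left)
  have fg: "f (g b) = b" if "b \<in> W" for b
    using bij that by (simp add: g_def bij_betw_inv_into_right)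
  have fW: "f a \<in> W" if "a \<in> V" for a using bij that by (auto simp: bij_betw_def)
  have gV: "g b \<in> V" if "b \<in> W" for b using bijg that by (auto simp: bij_betw_def)
  have sum_eq: "(\<Sum>w\<in>{w\<in>W. \<kappa>' w = i}. \<eta> w) = (\<Sum>v\<in>{v\<in>V. \<kappa> v = i}. \<omega> v)"
    if "\<And>v. v \<in> V \<Longrightarrow> \<kappa>' (f v) = \<kappa> v" for \<kappa> \<kappa>' :: "_ \<Rightarrow> nat" and i
  proof (rule sum.reindex_bij_witness[of _ f g])
    fix w assume "w \<in> {w\<in>W. \<kappa>' w = i}"
    then show "g w \<in> {v \<in> V. \<kappa> v = i}" using that[of "g w"] gV fg by auto
  qed (use fW gV fg gf that weight in auto)
  \<comment> \<open>Colourings are \<open>undefined\<close> off the vertex set, so composition with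
    \<open>g\<close> or \<open>f\<close> must be followed by a restriction.\<close>
  have "bij_betw (\<lambda>\<kappa>. restrict (\<kappa> \<circ> g) W) (colourings V E \<omega> \<alpha>) (colourings W F \<eta> \<alpha>)"
  proof (rule bij_betw_byWitness[where f' = "\<lambda>\<kappa>. restrict (\<kappa> \<circ> f) V"])
    show "\<forall>\<kappa>\<in>colourings V E \<omega> \<alpha>. restrict (restrict (\<kappa> \<circ> g) W \<circ> f) V = \<kappa>"
      by (auto simp: colourings_def fun_eq_iff restrict_def gf fW PiE_def extensional_def)
    show "\<forall>\<kappa>\<in>colourings W F \<eta> \<alpha>. restrict (restrict (\<kappa> \<circ> f) V \<circ> g) W = \<kappa>"
      by (auto simp: colourings_def fun_eq_iff restrict_def fg gV PiE_def extensional_def)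
    show "(\<lambda>\<kappa>. restrict (\<kappa> \<circ> g) W) ` colourings V E \<omega> \<alpha> \<subseteq> colourings W F \<eta> \<alpha>"
    proof safe
      fix \<kappa> assume k: "\<kappa> \<in> colourings V E \<omega> \<alpha>"
      then have "(\<Sum>w\<in>{w\<in>W. restrict (\<kappa> \<circ> g) W w = i}. \<eta> w) = \<alpha> i" for i
        using sum_eq[of "restrict (\<kappa> \<circ> g) W" \<kappa> i] gf fW by (simp add: colourings_def)
      moreover have "proper_colouring W F (restrict (\<kappa> \<circ> g) W)"
        using k edge by (auto simp: colourings_def proper_colouring_def gV fg)
      ultimately show "restrict (\<kappa> \<circ> g) W \<in> colourings W F \<eta> \<alpha>"
        by (simp add: colourings_def)
    qed
    show "(\<lambda>\<kappa>. restrict (\<kappa> \<circ> f) V) ` colourings W F \<eta> \<alpha> \<subseteq> colourings V E \<omega> \<alpha>"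
    proof safe
      fix \<kappa> assume k: "\<kappa> \<in> colourings W F \<eta> \<alpha>"
      then have "(\<Sum>v\<in>{v\<in>V. restrict (\<kappa> \<circ> f) V v = i}. \<omega> v) = \<alpha> i" for i
        using sum_eq[of \<kappa> "restrict (\<kappa> \<circ> f) V" i] by (simp add: colourings_def)
      moreover have "proper_colouring V E (restrict (\<kappa> \<circ> f) V)"
        using k edge by (auto simp: colourings_def proper_colouring_def fW)
      ultimately show "restrict (\<kappa> \<circ> f) V \<in> colourings V E \<omega> \<alpha>"
        by (simp add: colourings_def)
    qed
  qed
  then show "chrom_sym V E \<omega> \<alpha> = chrom_sym W F \<eta> \<alpha>"
    by (simp add: chrom_sym_colourings bij_betw_same_card)
qed

lemma chrom_sym_cong:
  assumes "\<And>a b. a \<in> V \<Longrightarrow> b \<in> V \<Longrightarrow> E a b \<longleftrightarrow> F a b" "\<And>a. a \<in> V \<Longrightarrow> \<omega> a = \<eta> a"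
  shows "chrom_sym V E \<omega> = chrom_sym V F \<eta>"
  by (rule chrom_sym_iso[where f = id]) (use assms in auto)

section \<open>Deletion and contraction\<close>

text \<open>Comparing unordered pairs removes both orientations, which keeps the relation
  symmetric.\<close>

definition delete_edge :: "('v \<Rightarrow> 'v \<Rightarrow> bool) \<Rightarrow> 'v \<Rightarrow> 'v \<Rightarrow> 'v \<Rightarrow> 'v \<Rightarrow> bool" where
  "delete_edge E u v a b \<longleftrightarrow> E a b \<and> {a, b} \<noteq> {u, v}"

definition merge_vertex :: "'v \<Rightarrow> 'v \<Rightarrow> 'v \<Rightarrow> 'v" where
  "merge_vertex u v a = (if a = v then u else a)"

text \<open>The vertex \<open>v\<close> is absorbed into \<open>u\<close>. The condition
  \<open>a \<noteq> b\<close> discards the loop left by the contracted edge, and parallel edges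
  coincide because edges form a relation.\<close>

definition contract_edge :: "('v \<Rightarrow> 'v \<Rightarrow> bool) \<Rightarrow> 'v \<Rightarrow> 'v \<Rightarrow> 'v \<Rightarrow> 'v \<Rightarrow> bool" where
  "contract_edge E u v a b \<longleftrightarrow>
     a \<noteq> b \<and> (\<exists>a' b'. E a' b' \<and> merge_vertex u v a' = a \<and> merge_vertex u v b' = b)"

lemma simple_graph_delete_edge:
  "simple_graph V E \<Longrightarrow> simple_graph V (delete_edge E u v)"
  by (auto simp: simple_graph_def delete_edge_def doubleton_eq_iff)

lemma simple_graph_contract_edge:
  assumes "simple_graph V E" "u \<in> V" "u \<noteq> v"
  shows "simple_graph (V - {v}) (contract_edge E u v)"
proof -
  have "contract_edge E u v b a" if "contract_edge E u v a b" for a b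
    using that assms(1) unfolding simple_graph_def contract_edge_def by metis
  moreover have "a \<in> V - {v} \<and> b \<in> V - {v}" if "contract_edge E u v a b" for a b
    using that assms unfolding simple_graph_def contract_edge_def merge_vertex_def
    by (auto split: if_splits)
  moreover have "\<not> contract_edge E u v a a" for a
    by (simp add: contract_edge_def)
  ultimately show ?thesis
    using assms(1) unfolding simple_graph_def by blast
qed

text \<open>Used for single colour classes in deletion-contraction, and for whole vertex sets to see
  that contraction keeps the total weight.\<close>

lemma sum_merge_vertex:
  fixes \<omega> :: "'v \<Rightarrow> nat"
  assumes "finite V" "u \<in> V" "v \<in> V" "u \<noteq> v"
  shows "(\<Sum>a\<in>V - {v}. (\<omega>(u := \<omega> u + \<omega> v)) a) = (\<Sum>a\<in>V. \<omega> a)"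
proof -
  have "(\<Sum>a\<in>V - {v}. (\<omega>(u := \<omega> u + \<omega> v)) a)
      = \<omega> u + \<omega> v + (\<Sum>a\<in>V - {v} - {u}. (\<omega>(u := \<omega> u + \<omega> v)) a)"
    using assms by (subst sum.remove[of _ u]) auto
  also have "(\<Sum>a\<in>V - {v} - {u}. (\<omega>(u := \<omega> u + \<omega> v)) a) = (\<Sum>a\<in>V - {v} - {u}. \<omega> a)"
    by (intro sum.cong) auto
  also have "\<omega> u + \<omega> v + \<dots> = (\<Sum>a\<in>V. \<omega> a)"
    using assms by (simp add: sum.remove[of V v] sum.remove[of "V - {v}" u])
  finally show ?thesis .
qed

text \<open>Split the proper colourings of the deletion by their values at \<open>u\<close> and
  \<open>v\<close>. Those with distinct values are the proper colourings of the graph. Those with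
  equal values factor through the merging map and are the proper colourings of the contraction,
  where the merged vertex brings both weights into its colour class.\<close>

theorem chrom_sym_deletion_contraction:
  assumes G: "simple_graph V E" and w: "\<forall>v\<in>V. 1 \<le> \<omega> v" and e: "E u v"
  shows "chrom_sym V (delete_edge E u v) \<omega> \<alpha> =
     chrom_sym V E \<omega> \<alpha> + chrom_sym (V - {v}) (contract_edge E u v) (\<omega>(u := \<omega> u + \<omega> v)) \<alpha>"
proof -
  let ?D = "colourings V (delete_edge E u v) \<omega> \<alpha>"
  let ?C = "colourings (V - {v}) (contract_edge E u v) (\<omega>(u := \<omega> u + \<omega> v)) \<alpha>"
  let ?S = "{\<kappa> \<in> ?D. \<kappa> u = \<kappa> v}"
  have V: "finite V" "u \<in> V" "v \<in> V" "u \<noteq> v"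
    using G e by (auto simp: simple_graph_def)
  have EV: "E a b \<Longrightarrow> a \<in> V \<and> b \<in> V" for a b using G by (auto simp: simple_graph_def)
  have E_eq: "colourings V E \<omega> \<alpha> = {\<kappa> \<in> ?D. \<kappa> u \<noteq> \<kappa> v}"
  proof -
    have "proper_colouring V E \<kappa> \<longleftrightarrow> proper_colouring V (delete_edge E u v) \<kappa> \<and> \<kappa> u \<noteq> \<kappa> v"
      for \<kappa>
      using V e by (auto simp: proper_colouring_def delete_edge_def doubleton_eq_iff) metis
    then show ?thesis by (auto simp: colourings_def)
  qed
  \<comment> \<open>Properness and weights are compared for any pair with \<open>\<kappa>\<close>
    equal to \<open>\<kappa>'\<close> after merging, so that both directions of the bijection below
    can use the comparison.\<close>
  have proper_iff: "proper_colouring (V - {v}) (contract_edge E u v) \<kappa>'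
      \<longleftrightarrow> proper_colouring V (delete_edge E u v) \<kappa>"
    if k: "\<And>a. a \<in> V \<Longrightarrow> \<kappa> a = \<kappa>' (merge_vertex u v a)" for \<kappa> \<kappa>' :: "_ \<Rightarrow> nat"
  proof
    assume L: "proper_colouring (V - {v}) (contract_edge E u v) \<kappa>'"
    show "proper_colouring V (delete_edge E u v) \<kappa>"
      unfolding proper_colouring_def
    proof (intro ballI impI)
      fix a b assume ab: "a \<in> V" "b \<in> V" "delete_edge E u v a b"
      then have "a \<noteq> b" using G by (auto simp: delete_edge_def simple_graph_def)
      then have "contract_edge E u v (merge_vertex u v a) (merge_vertex u v b)"
        using ab by (auto simp: delete_edge_def contract_edge_def merge_vertex_def)
      then show "\<kappa> a \<noteq> \<kappa> b"
        using L ab k V by (auto simp: proper_colouring_def merge_vertex_def split: if_splits)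
    qed
  next
    assume R: "proper_colouring V (delete_edge E u v) \<kappa>"
    show "proper_colouring (V - {v}) (contract_edge E u v) \<kappa>'"
      unfolding proper_colouring_def
    proof (intro ballI impI)
      fix a b assume "contract_edge E u v a b"
      then obtain a' b' where *: "a \<noteq> b" "E a' b'" "merge_vertex u v a' = a" "merge_vertex u v b' = b"
        by (auto simp: contract_edge_def)
      \<comment> \<open>The deleted edge is excluded by \<open>a \<noteq> b\<close>, since both of
        its ends merge into \<open>u\<close>.\<close>
      then have "delete_edge E u v a' b'"
        by (auto simp: delete_edge_def merge_vertex_def doubleton_eq_iff)
      then have "\<kappa> a' \<noteq> \<kappa> b'" using R * EV by (auto simp: proper_colouring_def)
      then show "\<kappa>' a \<noteq> \<kappa>' b" using k * EV by metis
    qed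
  qed
  have weight: "(\<Sum>a\<in>{a\<in>V - {v}. \<kappa>' a = i}. (\<omega>(u := \<omega> u + \<omega> v)) a) = (\<Sum>a\<in>{a\<in>V. \<kappa> a = i}. \<omega> a)"
    if k: "\<And>a. a \<in> V \<Longrightarrow> \<kappa> a = \<kappa>' (merge_vertex u v a)" for \<kappa> \<kappa>' :: "_ \<Rightarrow> nat" and i
  proof (cases "\<kappa> u = i")
    case True
    then have "{a\<in>V - {v}. \<kappa>' a = i} = {a\<in>V. \<kappa> a = i} - {v}"
      using k V by (auto simp: merge_vertex_def)
    moreover have "\<kappa> v = i" using True k V by (simp add: merge_vertex_def)
    ultimately show ?thesis
      using sum_merge_vertex[of "{a\<in>V. \<kappa> a = i}" u v \<omega>] V True by simp
  next
    case False
    then have "{a\<in>V - {v}. \<kappa>' a = i} = {a\<in>V. \<kappa> a = i}" "u \<notin> {a\<in>V. \<kappa> a = i}"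
      using k V by (auto simp: merge_vertex_def split: if_splits)
    note eq = this
    show ?thesis unfolding eq(1) using eq(2) by (intro sum.cong) auto
  qed
  \<comment> \<open>Restriction forgets the colour of \<open>v\<close>, which on \<open>?S\<close>
    equals that of \<open>u\<close>; composing with \<open>merge_vertex\<close> restores it.\<close>
  have "bij_betw (\<lambda>\<kappa>. restrict \<kappa> (V - {v})) ?S ?C"
  proof (rule bij_betw_byWitness[where f' = "\<lambda>\<kappa>. restrict (\<kappa> \<circ> merge_vertex u v) V"])
    show "\<forall>\<kappa>\<in>?S. restrict (restrict \<kappa> (V - {v}) \<circ> merge_vertex u v) V = \<kappa>"
      using V by (auto simp: colourings_def fun_eq_iff restrict_def merge_vertex_def PiE_def extensional_def)
    show "\<forall>\<kappa>\<in>?C. restrict (restrict (\<kappa> \<circ> merge_vertex u v) V) (V - {v}) = \<kappa>"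
      using V by (auto simp: colourings_def fun_eq_iff restrict_def merge_vertex_def PiE_def extensional_def)
    show "(\<lambda>\<kappa>. restrict \<kappa> (V - {v})) ` ?S \<subseteq> ?C"
    proof safe
      fix \<kappa> assume k: "\<kappa> \<in> ?D" "\<kappa> u = \<kappa> v"
      have "\<kappa> a = restrict \<kappa> (V - {v}) (merge_vertex u v a)" if "a \<in> V" for a
        using that V k by (simp add: merge_vertex_def)
      note * = proper_iff[of \<kappa> "restrict \<kappa> (V - {v})", OF this]
        weight[of \<kappa> "restrict \<kappa> (V - {v})", OF this]
      show "restrict \<kappa> (V - {v}) \<in> ?C"
        using k(1) unfolding colourings_def by (auto simp only: mem_Collect_eq *) auto
    qed
    show "(\<lambda>\<kappa>. restrict (\<kappa> \<circ> merge_vertex u v) V) ` ?C \<subseteq> ?S"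
    proof safe
      fix \<kappa> assume k: "\<kappa> \<in> ?C"
      have "restrict (\<kappa> \<circ> merge_vertex u v) V a = \<kappa> (merge_vertex u v a)" if "a \<in> V" for a
        using that by simp
      note * = proper_iff[of "restrict (\<kappa> \<circ> merge_vertex u v) V" \<kappa>, OF this]
        weight[of "restrict (\<kappa> \<circ> merge_vertex u v) V" \<kappa>, OF this]
      show "restrict (\<kappa> \<circ> merge_vertex u v) V \<in> ?D"
        using k unfolding colourings_def by (auto simp only: mem_Collect_eq *) auto
      show "restrict (\<kappa> \<circ> merge_vertex u v) V u = restrict (\<kappa> \<circ> merge_vertex u v) V v"
        using V by (simp add: merge_vertex_def)
    qed
  qed
  then have C: "card ?C = card ?S" by (simp add: bij_betw_same_card)
  have "finite ?D" using finite_colourings V(1) w by blast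
  then have "card ?D = card (colourings V E \<omega> \<alpha>) + card ?S"
    unfolding E_eq by (subst card_Un_disjoint[symmetric]) (auto intro!: arg_cong[where f = card])
  then show ?thesis by (simp add: chrom_sym_colourings C)
qed

section \<open>Path expansions\<close>

text \<open>The relation behind the description in \<open>tau\<close>: existence and uniqueness of
  the polynomial can be treated separately.\<close>

definition has_tau :: "sym_fun \<Rightarrow> rat poly \<Rightarrow> bool" where
  "has_tau f p \<longleftrightarrow> (\<exists>a. path_expansion f a \<and>
     p = (\<Sum>ls\<in>{ls. a ls \<noteq> 0}. monom (a ls) (length ls)))"

lemma has_tau_X_path:
  assumes "ls \<in> partitions"
  shows "has_tau (X_path ls) (monom 1 (length ls))"
proof -
  let ?a = "\<lambda>ls'. if ls' = ls then 1 else 0 :: rat"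
  have "{ls'. ?a ls' \<noteq> 0} = {ls}" by auto
  then show ?thesis
    using assms unfolding has_tau_def path_expansion_def by (intro exI[of _ ?a]) auto
qed

text \<open>The form of linearity that deletion-contraction calls for once it is solved for one of
  its terms.\<close>

lemma has_tau_diff:
  assumes "has_tau f p" "has_tau g q"
  shows "has_tau (\<lambda>\<alpha>. f \<alpha> - g \<alpha>) (p - q)"
proof -
  obtain a where a: "path_expansion f a" "p = (\<Sum>ls\<in>{ls. a ls \<noteq> 0}. monom (a ls) (length ls))"
    using assms(1) by (auto simp: has_tau_def)
  obtain b where b: "path_expansion g b" "q = (\<Sum>ls\<in>{ls. b ls \<noteq> 0}. monom (b ls) (length ls))"
    using assms(2) by (auto simp: has_tau_def)
  let ?c = "\<lambda>ls. a ls - b ls"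
  let ?S = "{ls. a ls \<noteq> 0} \<union> {ls. b ls \<noteq> 0}"
  have fin: "finite ?S" and sub: "?S \<subseteq> partitions"
    using a(1) b(1) by (auto simp: path_expansion_def)
  have cS: "{ls. ?c ls \<noteq> 0} \<subseteq> ?S" by auto
  \<comment> \<open>Coefficients may cancel, so the support of the difference can be smaller than
    \<open>?S\<close>; all sums are first extended by zeros to \<open>?S\<close>.\<close>
  have extend: "(\<Sum>ls\<in>T. h ls) = (\<Sum>ls\<in>?S. h ls)"
    if "T \<subseteq> ?S" "\<And>ls. ls \<notin> T \<Longrightarrow> h ls = 0" for T and h :: "nat list \<Rightarrow> 'b::comm_monoid_add"
    using fin that by (intro sum.mono_neutral_left) auto
  have "f \<alpha> - g \<alpha> = (\<Sum>ls\<in>{ls. ?c ls \<noteq> 0}. ?c ls * X_path ls \<alpha>)" for \<alpha>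
  proof -
    have "f \<alpha> = (\<Sum>ls\<in>?S. a ls * X_path ls \<alpha>)"
      using a(1) extend[of "{ls. a ls \<noteq> 0}" "\<lambda>ls. a ls * X_path ls \<alpha>"] by (simp add: path_expansion_def)
    moreover have "g \<alpha> = (\<Sum>ls\<in>?S. b ls * X_path ls \<alpha>)"
      using b(1) extend[of "{ls. b ls \<noteq> 0}" "\<lambda>ls. b ls * X_path ls \<alpha>"] by (simp add: path_expansion_def)
    moreover have "(\<Sum>ls\<in>{ls. ?c ls \<noteq> 0}. ?c ls * X_path ls \<alpha>) = (\<Sum>ls\<in>?S. ?c ls * X_path ls \<alpha>)"
      using cS by (intro extend) auto
    ultimately show ?thesis by (simp add: sum_subtractf left_diff_distrib)
  qed
  then have "path_expansion (\<lambda>\<alpha>. f \<alpha> - g \<alpha>) ?c"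
    using fin sub cS unfolding path_expansion_def by (meson finite_subset order_trans)
  moreover have "p - q = (\<Sum>ls\<in>{ls. ?c ls \<noteq> 0}. monom (?c ls) (length ls))"
  proof -
    have "p = (\<Sum>ls\<in>?S. monom (a ls) (length ls))"
      using a(2) extend[of "{ls. a ls \<noteq> 0}" "\<lambda>ls. monom (a ls) (length ls)"] by simp
    moreover have "q = (\<Sum>ls\<in>?S. monom (b ls) (length ls))"
      using b(2) extend[of "{ls. b ls \<noteq> 0}" "\<lambda>ls. monom (b ls) (length ls)"] by simp
    moreover have "(\<Sum>ls\<in>{ls. ?c ls \<noteq> 0}. monom (?c ls) (length ls)) = (\<Sum>ls\<in>?S. monom (?c ls) (length ls))"
      using cS by (intro extend) auto
    ultimately show ?thesis by (simp add: sum_subtractf flip: diff_monom)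
  qed
  ultimately show ?thesis unfolding has_tau_def by blast
qed

section \<open>Vertex sets of path forests\<close>

lemma finite_path_verts: "finite (path_verts ls)"
proof -
  have "path_verts ls \<subseteq> (\<Union>i\<in>{..<length ls}. {i} \<times> {..<ls ! i})"
    by (auto simp: path_verts_def)
  then show ?thesis by (rule finite_subset) auto
qed

lemma simple_graph_path: "simple_graph (path_verts ls) (path_edge ls)"
  by (auto simp: simple_graph_def finite_path_verts path_edge_def)

text \<open>Allows a further path to be built one vertex at a time, starting from the empty path of
  \<open>path_verts_snoc_0\<close>.\<close>

lemma path_verts_snoc:
  "path_verts (ls @ [Suc k]) = insert (length ls, k) (path_verts (ls @ [k]))"
proof -
  have "(i, j) \<in> path_verts (ls @ [Suc k]) \<longleftrightarrow> (i, j) \<in> insert (length ls, k) (path_verts (ls @ [k]))"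
    for i j
    by (cases "i < length ls"; cases "i = length ls") (auto simp: path_verts_def nth_append)
  then show ?thesis by auto
qed

lemma path_verts_snoc_0: "path_verts (ls @ [0]) = path_verts ls"
proof -
  have "i < length (ls @ [0]) \<and> j < (ls @ [0]) ! i \<longleftrightarrow> i < length ls \<and> j < ls ! i" for i j
    by (cases "i < length ls") (auto simp: nth_append nth_Cons split: nat.splits)
  then show ?thesis unfolding path_verts_def by blast
qed

lemma path_verts_update:
  "i < length ls \<Longrightarrow> path_verts (ls[i := Suc (ls ! i)]) = insert (i, ls ! i) (path_verts ls)"
proof -
  assume i: "i < length ls"
  have "(i', j) \<in> path_verts (ls[i := Suc (ls ! i)]) \<longleftrightarrow> (i', j) \<in> insert (i, ls ! i) (path_verts ls)"
    for i' j
    using i by (cases "i' = i") (auto simp: path_verts_def)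
  then show ?thesis by auto
qed

section \<open>Specialisation and uniqueness of the tree polynomial\<close>

text \<open>The cardinality of this set is the chromatic polynomial evaluated at
  \<open>M\<close>.\<close>

definition proper_colourings :: "'v set \<Rightarrow> ('v \<Rightarrow> 'v \<Rightarrow> bool) \<Rightarrow> nat \<Rightarrow> ('v \<Rightarrow> nat) set" where
  "proper_colourings V E M = {\<kappa> \<in> V \<rightarrow>\<^sub>E {..<M}. proper_colouring V E \<kappa>}"

lemma proper_colourings_cong:
  assumes "\<And>a b. a \<in> V \<Longrightarrow> b \<in> V \<Longrightarrow> E a b \<longleftrightarrow> F a b"
  shows "proper_colourings V E M = proper_colourings V F M"
  using assms by (auto simp: proper_colourings_def proper_colouring_def)

lemma finite_proper_colourings: "finite V \<Longrightarrow> finite (proper_colourings V E M)"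
  using finite_PiE[of V "\<lambda>_. {..<M}"] by (simp add: proper_colourings_def)

text \<open>Colour \<open>V\<close> first; then \<open>v\<close> may take any colour that does not
  occur on its neighbours.\<close>

lemma card_proper_colourings_insert:
  assumes V: "finite V" "v \<notin> V" and E: "\<And>a. \<not> E a a"
  shows "card (proper_colourings (insert v V) E M) =
    (\<Sum>\<kappa>\<in>proper_colourings V E M. card ({..<M} - \<kappa> ` {u \<in> V. E u v \<or> E v u}))"
proof -
  let ?N = "{u \<in> V. E u v \<or> E v u}"
  let ?S = "SIGMA \<kappa>:proper_colourings V E M. {..<M} - \<kappa> ` ?N"
  have "bij_betw (\<lambda>\<kappa>. (restrict \<kappa> V, \<kappa> v)) (proper_colourings (insert v V) E M) ?S"
  proof (rule bij_betw_byWitness[where f' = "\<lambda>(\<kappa>, c). \<kappa>(v := c)"])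
    show "\<forall>\<kappa>\<in>proper_colourings (insert v V) E M.
        (\<lambda>(\<kappa>, c). \<kappa>(v := c)) (restrict \<kappa> V, \<kappa> v) = \<kappa>"
      by (auto simp: proper_colourings_def fun_eq_iff PiE_def extensional_def restrict_def)
    show "\<forall>p\<in>?S. (restrict ((\<lambda>(\<kappa>, c). \<kappa>(v := c)) p) V, (\<lambda>(\<kappa>, c). \<kappa>(v := c)) p v) = p"
      using V by (auto simp: proper_colourings_def fun_eq_iff PiE_def extensional_def restrict_def)
    show "(\<lambda>\<kappa>. (restrict \<kappa> V, \<kappa> v)) ` proper_colourings (insert v V) E M \<subseteq> ?S"
      by (auto simp: proper_colourings_def proper_colouring_def)
    show "(\<lambda>(\<kappa>, c). \<kappa>(v := c)) ` ?S \<subseteq> proper_colourings (insert v V) E M"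
    proof (rule image_subsetI)
      fix p assume "p \<in> ?S"
      then obtain \<kappa> c where p: "p = (\<kappa>, c)" and k: "\<kappa> \<in> proper_colourings V E M"
        and c: "c \<in> {..<M}" "c \<notin> \<kappa> ` ?N" by blast
      have "(\<kappa>(v := c)) a \<noteq> (\<kappa>(v := c)) b"
        if "a \<in> insert v V" "b \<in> insert v V" "E a b" for a b
        using that k c V E by (cases "a = v"; cases "b = v")
          (auto simp: proper_colourings_def proper_colouring_def)
      then show "(\<lambda>(\<kappa>, c). \<kappa>(v := c)) p \<in> proper_colourings (insert v V) E M"
        using k c(1) unfolding p prod.case proper_colourings_def proper_colouring_def
        by (auto simp only: mem_Collect_eq intro!: PiE_fun_upd)
    qed
  qed
  then have "card (proper_colourings (insert v V) E M) = card ?S"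
    by (rule bij_betw_same_card)
  also have "\<dots> = (\<Sum>\<kappa>\<in>proper_colourings V E M. card ({..<M} - \<kappa> ` ?N))"
    using finite_proper_colourings[OF V(1)] by (intro card_SigmaI) auto
  finally show ?thesis .
qed

text \<open>Adding vertices along each path, the first one has \<open>M\<close> choices and every
  later one \<open>M - 1\<close>, because its only neighbour so far is its predecessor. The second
  conjunct keeps the subtraction in the exponent from being truncated.\<close>

lemma card_proper_colourings_path:
  assumes "\<forall>l\<in>set ls. 0 < l"
  shows "card (proper_colourings (path_verts ls) (path_edge ls) M) =
    M ^ length ls * (M - 1) ^ (card (path_verts ls) - length ls)
    \<and> length ls \<le> card (path_verts ls)"
  using assms
proof (induction ls rule: rev_induct)
  case Nil
  have "proper_colourings {} (path_edge []) M = {\<lambda>_. undefined}"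
    by (auto simp: proper_colourings_def proper_colouring_def)
  then show ?case by (simp add: path_verts_def)
next
  case (snoc l ls)
  have IH: "card (proper_colourings (path_verts ls) (path_edge ls) M) =
    M ^ length ls * (M - 1) ^ (card (path_verts ls) - length ls)" "length ls \<le> card (path_verts ls)"
    using snoc by auto
  have step: "card (proper_colourings (path_verts (ls @ [Suc k])) (path_edge (ls @ [Suc k])) M) =
    card (proper_colourings (path_verts (ls @ [k])) (path_edge (ls @ [k])) M) * (if k = 0 then M else M - 1)"
    and step_card: "card (path_verts (ls @ [Suc k])) = Suc (card (path_verts (ls @ [k])))" for k
  proof -
    let ?E = "path_edge (ls @ [Suc k])" and ?v = "(length ls, k)" and ?V = "path_verts (ls @ [k])"
    have v: "?v \<notin> ?V" by (simp add: path_verts_def)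
    have "{u \<in> ?V. ?E u ?v \<or> ?E ?v u} = (if k = 0 then {} else {(length ls, k - 1)})"
      by (auto simp: path_edge_def path_verts_def nth_append)
    moreover have "card ({..<M} - \<kappa> ` (if k = 0 then {} else {(length ls, k - 1)})) =
        (if k = 0 then M else M - 1)" if "\<kappa> \<in> proper_colourings ?V ?E M" for \<kappa>
    proof -
      have "\<kappa> (length ls, k - 1) < M" if "k \<noteq> 0"
        using that \<open>\<kappa> \<in> _\<close> by (auto simp: proper_colourings_def path_verts_def PiE_iff)
      then show ?thesis by simp
    qed
    moreover have "\<not> ?E a a" for a by (simp add: path_edge_def)
    ultimately have "card (proper_colourings (insert ?v ?V) ?E M) =
        card (proper_colourings ?V ?E M) * (if k = 0 then M else M - 1)"
      using v finite_path_verts by (subst card_proper_colourings_insert) auto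
    also have "proper_colourings ?V ?E M = proper_colourings ?V (path_edge (ls @ [k])) M"
      by (rule proper_colourings_cong) (simp add: path_edge_def path_verts_snoc)
    finally show "card (proper_colourings (path_verts (ls @ [Suc k])) ?E M) =
        card (proper_colourings ?V (path_edge (ls @ [k])) M) * (if k = 0 then M else M - 1)"
      by (simp add: path_verts_snoc)
    show "card (path_verts (ls @ [Suc k])) = Suc (card ?V)"
      using v finite_path_verts by (simp add: path_verts_snoc)
  qed
  have zero: "proper_colourings (path_verts (ls @ [0])) (path_edge (ls @ [0])) M =
      proper_colourings (path_verts ls) (path_edge ls) M"
    by (simp add: path_verts_snoc_0, rule proper_colourings_cong)
       (simp add: path_edge_def path_verts_snoc_0)
  have "card (proper_colourings (path_verts (ls @ [Suc k])) (path_edge (ls @ [Suc k])) M) =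
      M ^ Suc (length ls) * (M - 1) ^ (card (path_verts ls) - length ls + k)
      \<and> card (path_verts (ls @ [Suc k])) = card (path_verts ls) + Suc k" for k
  proof (induction k)
    case 0
    then show ?case
      using step[of 0] step_card[of 0] IH zero by (simp add: path_verts_snoc_0)
  next
    case (Suc k)
    then show ?case using step[of "Suc k"] step_card[of "Suc k"] by simp
  qed
  \<comment> \<open>Positivity of \<open>l\<close> makes it the successor of
    \<open>l - 1\<close>.\<close>
  from this[of "l - 1"] show ?case using IH snoc.prems by auto
qed

section \<open>Evaluation at finitely many equal variables\<close>

text \<open>Bounding each exponent by \<open>D\<close> turns the evaluation of a formal series into
  a finite sum.\<close>

definition exponents :: "nat \<Rightarrow> nat \<Rightarrow> (nat \<Rightarrow> nat) set" where
  "exponents M D = {\<alpha>. \<forall>i. (i \<in> {..<M} \<longrightarrow> \<alpha> i \<in> {..D}) \<and> (i \<notin> {..<M} \<longrightarrow> \<alpha> i = 0)}"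

text \<open>The value of the part of \<open>f\<close> of degree at most \<open>D\<close> in each variable at
  \<open>x\<^sub>i = y\<close> for \<open>i < M\<close> and \<open>x\<^sub>i = 0\<close> otherwise.\<close>

definition specialise :: "rat \<Rightarrow> nat \<Rightarrow> nat \<Rightarrow> sym_fun \<Rightarrow> rat" where
  "specialise y M D f = (\<Sum>\<alpha>\<in>exponents M D. f \<alpha> * y ^ (\<Sum>i<M. \<alpha> i))"

lemma finite_exponents: "finite (exponents M D)"
  unfolding exponents_def by (rule finite_set_of_finite_funs) auto

text \<open>Group the proper \<open>M\<close>-colourings by the exponent vector of their monomial.
  Each colouring contributes \<open>y\<close> to the power of the total weight, and \<open>D\<close>
  is large enough for no monomial in the first \<open>M\<close> variables to be cut off.\<close>

lemma specialise_chrom_sym: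
  assumes V: "finite V" and w: "\<forall>v\<in>V. 1 \<le> \<omega> v" and D: "(\<Sum>v\<in>V. \<omega> v) \<le> D"
  shows "specialise y M D (chrom_sym V E \<omega>) =
    of_nat (card (proper_colourings V E M)) * y ^ (\<Sum>v\<in>V. \<omega> v)"
proof -
  let ?K = "proper_colourings V E M"
  define content where "content \<kappa> i = (\<Sum>v\<in>{v\<in>V. \<kappa> v = i}. \<omega> v)" for \<kappa> :: "_ \<Rightarrow> nat" and i
  have exps: "content ` ?K \<subseteq> exponents M D"
  proof
    fix \<alpha> assume "\<alpha> \<in> content ` ?K"
    then obtain \<kappa> where k: "\<alpha> = content \<kappa>" "\<kappa> \<in> ?K" by blast
    have "content \<kappa> i \<le> D" for i
    proof -
      have "content \<kappa> i \<le> (\<Sum>v\<in>V. \<omega> v)"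
        unfolding content_def using V by (intro sum_mono2) auto
      then show ?thesis using D by simp
    qed
    moreover have "content \<kappa> i = 0" if "\<not> i < M" for i
    proof -
      have empty: "{v\<in>V. \<kappa> v = i} = {}" using k that by (auto simp: proper_colourings_def)
      show ?thesis unfolding content_def empty by simp
    qed
    ultimately show "\<alpha> \<in> exponents M D" by (simp add: k exponents_def)
  qed
  \<comment> \<open>Weights are positive, so every colour in use has a nonzero exponent and hence
    lies below \<open>M\<close>.\<close>
  have fibre: "colourings V E \<omega> \<alpha> = {\<kappa>\<in>?K. content \<kappa> = \<alpha>}" if "\<alpha> \<in> exponents M D" for \<alpha>
  proof -
    have "\<kappa> v < M" if k: "\<kappa> \<in> colourings V E \<omega> \<alpha>" and "v \<in> V" for \<kappa> v
    proof (rule ccontr)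
      assume "\<not> \<kappa> v < M"
      then have "\<alpha> (\<kappa> v) = 0" using \<open>\<alpha> \<in> exponents M D\<close> by (simp add: exponents_def)
      then show False using colourings_weight_pos[OF V w k \<open>v \<in> V\<close>] by simp
    qed
    moreover have "\<kappa> \<in> colourings V E \<omega> \<alpha> \<longleftrightarrow>
        \<kappa> \<in> V \<rightarrow>\<^sub>E UNIV \<and> proper_colouring V E \<kappa> \<and> content \<kappa> = \<alpha>" for \<kappa>
      by (simp add: colourings_def content_def fun_eq_iff)
    ultimately show ?thesis
      unfolding proper_colourings_def by (auto simp: PiE_iff)
  qed
  have total: "(\<Sum>i<M. content \<kappa> i) = (\<Sum>v\<in>V. \<omega> v)" if "\<kappa> \<in> ?K" for \<kappa>
    unfolding content_def using that V sum.group[of V "{..<M}" \<kappa> \<omega>]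
    by (simp add: proper_colourings_def PiE_iff image_subset_iff)
  have "of_nat (card ?K) * y ^ (\<Sum>v\<in>V. \<omega> v) = (\<Sum>\<kappa>\<in>?K. y ^ (\<Sum>i<M. content \<kappa> i))"
    using total by simp
  also have "\<dots> = (\<Sum>\<alpha>\<in>exponents M D. \<Sum>\<kappa>\<in>{\<kappa>\<in>?K. content \<kappa> = \<alpha>}. y ^ (\<Sum>i<M. content \<kappa> i))"
    using finite_proper_colourings[OF V] finite_exponents exps by (intro sum.group[symmetric])
  also have "\<dots> = (\<Sum>\<alpha>\<in>exponents M D. chrom_sym V E \<omega> \<alpha> * y ^ (\<Sum>i<M. \<alpha> i))"
    by (intro sum.cong refl) (simp add: chrom_sym_colourings fibre)
  finally show ?thesis by (simp add: specialise_def)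
qed

text \<open>The choice \<open>y = 1 / (M - 1)\<close> cancels the powers of \<open>M - 1\<close> in
  the colouring count until only the number of paths matters.\<close>

lemma specialise_X_path:
  assumes "ls \<in> partitions" "card (path_verts ls) \<le> D" "2 \<le> M"
  shows "specialise (1 / of_nat (M - 1)) M D (X_path ls) = (of_nat M / of_nat (M - 1)) ^ length ls"
proof -
  have pos: "\<forall>l\<in>set ls. 0 < l" using assms(1) by (auto simp: partitions_def)
  note P = card_proper_colourings_path[OF pos, of M]
  have "specialise (1 / of_nat (M - 1)) M D (X_path ls) =
      of_nat (M ^ length ls * (M - 1) ^ (card (path_verts ls) - length ls))
        * (1 / of_nat (M - 1)) ^ card (path_verts ls)"
    unfolding X_path_def using assms P finite_path_verts by (subst specialise_chrom_sym) auto
  also have "card (path_verts ls) = (card (path_verts ls) - length ls) + length ls"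
    using P by simp
  then have "(1 / of_nat (M - 1) :: rat) ^ card (path_verts ls) =
      (1 / of_nat (M - 1)) ^ (card (path_verts ls) - length ls) * (1 / of_nat (M - 1)) ^ length ls"
    by (metis power_add)
  finally show ?thesis
    using assms(3) by (simp add: power_divide power_one_over)
qed

section \<open>Independence of the tree polynomial from the expansion\<close>

text \<open>The forests in one expansion are finitely many, so one bound \<open>D\<close> serves
  them all. Stating the result for all larger \<open>D\<close> lets two expansions be compared at a
  common bound.\<close>

lemma specialise_has_tau:
  assumes "has_tau f p"
  shows "\<exists>D0. \<forall>D\<ge>D0. \<forall>M\<ge>2.
    specialise (1 / of_nat (M - 1)) M D f = poly p (of_nat M / of_nat (M - 1))"
proof -
  obtain a where a: "path_expansion f a" "p = (\<Sum>ls\<in>{ls. a ls \<noteq> 0}. monom (a ls) (length ls))"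
    using assms by (auto simp: has_tau_def)
  let ?S = "{ls. a ls \<noteq> 0}"
  have fin: "finite ?S" and sub: "?S \<subseteq> partitions"
    and f: "\<And>\<alpha>. f \<alpha> = (\<Sum>ls\<in>?S. a ls * X_path ls \<alpha>)"
    using a(1) by (auto simp: path_expansion_def)
  show ?thesis
  proof (intro exI allI impI)
    fix D M :: nat
    \<comment> \<open>This fixes the threshold: the sum bounds the number of vertices of every
      forest in the expansion.\<close>
    assume D: "(\<Sum>ls\<in>?S. card (path_verts ls)) \<le> D" and M: "2 \<le> M"
    have le: "card (path_verts ls) \<le> D" if "ls \<in> ?S" for ls
      using D member_le_sum[of ls ?S "\<lambda>ls. card (path_verts ls)"] fin that by simp
    have "specialise (1 / of_nat (M - 1)) M D f =
        (\<Sum>ls\<in>?S. a ls * specialise (1 / of_nat (M - 1)) M D (X_path ls))"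
      unfolding specialise_def f sum_distrib_right sum_distrib_left
      by (subst sum.swap) (simp add: mult.assoc)
    also have "\<dots> = (\<Sum>ls\<in>?S. a ls * (of_nat M / of_nat (M - 1)) ^ length ls)"
      using sub le M by (intro sum.cong refl) (metis specialise_X_path subsetD)
    also have "\<dots> = poly p (of_nat M / of_nat (M - 1))"
      by (simp add: a(2) poly_sum poly_monom)
    finally show "specialise (1 / of_nat (M - 1)) M D f = poly p (of_nat M / of_nat (M - 1))" .
  qed
qed

text \<open>The specialised value depends on \<open>f\<close> alone, so \<open>p\<close> and
  \<open>q\<close> agree at all points \<open>M / (M - 1)\<close> with \<open>2 \<le> M\<close>, and
  \<open>p - q\<close> has infinitely many roots.\<close>

lemma has_tau_unique:
  assumes "has_tau f p" "has_tau f q"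
  shows "p = q"
proof -
  obtain D1 where D1: "\<forall>D\<ge>D1. \<forall>M\<ge>2.
      specialise (1 / of_nat (M - 1)) M D f = poly p (of_nat M / of_nat (M - 1))"
    using specialise_has_tau[OF assms(1)] by blast
  obtain D2 where D2: "\<forall>D\<ge>D2. \<forall>M\<ge>2.
      specialise (1 / of_nat (M - 1)) M D f = poly q (of_nat M / of_nat (M - 1))"
    using specialise_has_tau[OF assms(2)] by blast
  let ?x = "\<lambda>M. of_nat M / of_nat (M - 1) :: rat"
  have "poly (p - q) (?x M) = 0" if "2 \<le> M" for M
  proof -
    have "poly p (?x M) = poly q (?x M)"
      using D1[rule_format, of "max D1 D2" M] D2[rule_format, of "max D1 D2" M] that
      by simp
    then show ?thesis by simp
  qed
  then have "?x ` {2..} \<subseteq> {x. poly (p - q) x = 0}" by auto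
  \<comment> \<open>Here \<open>?x M = 1 + 1 / (M - 1)\<close>, so distinct \<open>M\<close> give
    distinct points.\<close>
  moreover have "inj_on ?x {2..}"
  proof (rule inj_onI)
    fix M M' assume "M \<in> {2..}" "M' \<in> {2..}" "?x M = ?x M'"
    then show "M = M'" by (auto simp: field_simps of_nat_diff)
  qed
  then have "infinite (?x ` {2..})"
    using infinite_Ici finite_image_iff by blast
  ultimately have "infinite {x. poly (p - q) x = 0}" using finite_subset by blast
  then show ?thesis using poly_roots_finite[of "p - q"] by auto
qed

lemma tau_eq: "has_tau f p \<Longrightarrow> tau f = p"
  unfolding tau_def using has_tau_unique by (intro the_equality) (auto simp: has_tau_def)

section \<open>Existence of path expansions\<close>

text \<open>Permuting the paths gives an isomorphic forest. Expansions admit sorted lists only,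
  while the forests constructed below are unsorted.\<close>

lemma X_path_mset:
  assumes "mset ls = mset ls'"
  shows "X_path ls = X_path ls'"
proof -
  obtain f where f: "bij_betw f {..<length ls} {..<length ls'}"
      "\<And>i. i < length ls \<Longrightarrow> ls ! i = ls' ! f i"
    using permutation_Ex_bij[OF assms] by blast
  have inj: "f i = f i' \<longleftrightarrow> i = i'" if "i < length ls" "i' < length ls" for i i'
    using f(1) that by (auto simp: bij_betw_def inj_on_def)
  have less: "f i < length ls'" if "i < length ls" for i
    using f(1) that by (auto simp: bij_betw_def)
  have "bij_betw (map_prod f id) (path_verts ls) (path_verts ls')"
  proof (rule bij_betwI')
    show "(map_prod f id p = map_prod f id q) = (p = q)"
      if "p \<in> path_verts ls" "q \<in> path_verts ls" for p q
      using that inj by (auto simp: path_verts_def)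
    show "map_prod f id p \<in> path_verts ls'" if "p \<in> path_verts ls" for p
      using that less f(2) by (auto simp: path_verts_def)
    fix q assume q: "q \<in> path_verts ls'"
    then have "fst q \<in> f ` {..<length ls}" using f(1) by (auto simp: bij_betw_def path_verts_def)
    then obtain i where "i < length ls" "fst q = f i" by auto
    then show "\<exists>p\<in>path_verts ls. q = map_prod f id p"
      using q f(2) by (intro bexI[of _ "(i, snd q)"]) (auto simp: path_verts_def)
  qed
  then show ?thesis
    unfolding X_path_def
  proof (rule chrom_sym_iso)
    show "path_edge ls p q = path_edge ls' (map_prod f id p) (map_prod f id q)"
      if "p \<in> path_verts ls" "q \<in> path_verts ls" for p q
      using that inj less f(2) by (auto simp: path_edge_def path_verts_def)
  qed simp
qed

lemma has_tau_X_path_unsorted: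
  assumes "\<forall>l\<in>set ls. 0 < l"
  shows "has_tau (X_path ls) (monom 1 (length ls))"
proof -
  have "has_tau (X_path (rev (sort ls))) (monom 1 (length (rev (sort ls))))"
    using assms by (intro has_tau_X_path) (simp add: partitions_def)
  then show ?thesis using X_path_mset[of "rev (sort ls)" ls] by simp
qed

text \<open>Splitting a heavy last vertex into a vertex of weight 1 and one carrying the remaining
  weight, deletion and contraction express the forest through two forests of smaller excess; the
  new heavy vertex is again the last one of its path.\<close>

lemma has_tau_path_forest:
  assumes "\<forall>l\<in>set ls. 0 < l" and "\<forall>p\<in>path_verts ls. 1 \<le> \<omega> p"
    and "\<And>i j. i < length ls \<Longrightarrow> Suc j < ls ! i \<Longrightarrow> \<omega> (i, j) = 1"
    and "(\<Sum>p\<in>path_verts ls. \<omega> p) = card (path_verts ls) + e"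
  shows "has_tau (chrom_sym (path_verts ls) (path_edge ls) \<omega>) (monom 1 (length ls) * [:-1, 1:] ^ e)"
  using assms
proof (induction e arbitrary: ls \<omega>)
  case 0
  \<comment> \<open>With excess 0, one weight above 1 would already push the total beyond the number
    of vertices.\<close>
  have "\<omega> p = 1" if p: "p \<in> path_verts ls" for p
  proof (rule ccontr)
    assume "\<omega> p \<noteq> 1"
    then have "(\<Sum>p\<in>path_verts ls. 1) < (\<Sum>p\<in>path_verts ls. \<omega> p)"
      using 0(2) p finite_path_verts by (intro sum_strict_mono_ex1) (auto intro!: bexI[of _ p] le_neq_trans)
    then show False using 0(4) by simp
  qed
  then have "chrom_sym (path_verts ls) (path_edge ls) \<omega> = X_path ls"
    unfolding X_path_def by (intro chrom_sym_cong) auto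
  then show ?case using has_tau_X_path_unsorted[OF 0(1)] by simp
next
  case (Suc e)
  have "\<exists>p\<in>path_verts ls. 2 \<le> \<omega> p"
  proof (rule ccontr)
    assume "\<not> ?thesis"
    then have "(\<Sum>p\<in>path_verts ls. \<omega> p) \<le> (\<Sum>p\<in>path_verts ls. 1)"
      by (intro sum_mono) (auto simp: not_le)
    then show False using Suc.prems(4) by simp
  qed
  then obtain i j where ij: "i < length ls" "j < ls ! i" "2 \<le> \<omega> (i, j)"
    by (auto simp: path_verts_def)
  \<comment> \<open>A heavy vertex must end its path, because all earlier ones have weight
    1.\<close>
  then have j: "ls ! i = Suc j"
    using Suc.prems(3)[of i j] by (cases "Suc j < ls ! i") auto
  \<comment> \<open>In \<open>?ls1\<close> the split-off weight sits on a new end \<open>?v\<close>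
    of path \<open>i\<close>; in \<open>?ls2\<close> it sits on a separate one-vertex path
    \<open>?v'\<close>. Contracting the edge from \<open>?u\<close> to \<open>?v\<close> in the
    first forest returns the given one, and deleting it yields the second. Both have one vertex more
    at the same total weight, hence excess \<open>e\<close>.\<close>
  let ?u = "(i, j)" and ?v = "(i, Suc j)" and ?v' = "(length ls, 0 :: nat)"
  let ?ls1 = "ls[i := Suc (ls ! i)]" and ?ls2 = "ls @ [1]"
  let ?V = "path_verts ls" and ?V1 = "path_verts ?ls1" and ?V2 = "path_verts ?ls2"
  define \<eta>1 where "\<eta>1 = \<omega>(?u := 1, ?v := \<omega> ?u - 1)"
  define \<eta>2 where "\<eta>2 = \<omega>(?u := 1, ?v' := \<omega> ?u - 1)"
  have V1: "?V1 = insert ?v ?V" using path_verts_update[OF ij(1)] j by simp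
  have V2: "?V2 = insert ?v' ?V" by (simp add: path_verts_snoc path_verts_snoc_0)
  have notin: "?v \<notin> ?V" "?v' \<notin> ?V" "?u \<in> ?V" using ij j by (auto simp: path_verts_def)
  have sum1: "(\<Sum>p\<in>?V1. \<eta>1 p) = card ?V1 + e"
  proof -
    have "(\<Sum>p\<in>?V1. \<eta>1 p) = (\<Sum>p\<in>?V1 - {?v}. (\<eta>1(?u := \<eta>1 ?u + \<eta>1 ?v)) p)"
      using V1 notin finite_path_verts by (intro sum_merge_vertex[symmetric]) auto
    also have "\<dots> = (\<Sum>p\<in>?V. \<omega> p)"
      using V1 notin ij by (intro sum.cong) (auto simp: \<eta>1_def)
    finally show ?thesis using Suc.prems(4) V1 notin finite_path_verts by simp
  qed
  have sum2: "(\<Sum>p\<in>?V2. \<eta>2 p) = card ?V2 + e"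
  proof -
    have "(\<Sum>p\<in>?V2. \<eta>2 p) = (\<Sum>p\<in>?V2 - {?v'}. (\<eta>2(?u := \<eta>2 ?u + \<eta>2 ?v')) p)"
      using V2 notin finite_path_verts by (intro sum_merge_vertex[symmetric]) auto
    also have "\<dots> = (\<Sum>p\<in>?V. \<omega> p)"
      using V2 notin ij by (intro sum.cong) (auto simp: \<eta>2_def)
    finally show ?thesis using Suc.prems(4) V2 notin finite_path_verts by simp
  qed
  have pos1: "\<forall>p\<in>?V1. 1 \<le> \<eta>1 p" using Suc.prems(2) ij V1 by (auto simp: \<eta>1_def)
  have pos2: "\<forall>p\<in>?V2. 1 \<le> \<eta>2 p" using Suc.prems(2) ij V2 by (auto simp: \<eta>2_def)
  have tau1: "has_tau (chrom_sym ?V1 (path_edge ?ls1) \<eta>1) (monom 1 (length ?ls1) * [:-1, 1:] ^ e)"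
  proof (rule Suc.IH[OF _ pos1 _ sum1])
    show "\<forall>l\<in>set ?ls1. 0 < l"
      using Suc.prems(1) set_update_subset_insert[of ls i "Suc (ls ! i)"] by auto
    show "\<eta>1 (i', j') = 1" if "i' < length ?ls1" "Suc j' < ?ls1 ! i'" for i' j'
      using that Suc.prems(3)[of i' j'] j ij(1) by (cases "i' = i") (auto simp: \<eta>1_def)
  qed
  have tau2: "has_tau (chrom_sym ?V2 (path_edge ?ls2) \<eta>2) (monom 1 (length ?ls2) * [:-1, 1:] ^ e)"
  proof (rule Suc.IH[OF _ pos2 _ sum2])
    show "\<forall>l\<in>set ?ls2. 0 < l" using Suc.prems(1) by auto
    show "\<eta>2 (i', j') = 1" if "i' < length ?ls2" "Suc j' < ?ls2 ! i'" for i' j'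
      using that Suc.prems(3)[of i' j'] by (auto simp: \<eta>2_def nth_append split: if_splits)
  qed
  have edge: "path_edge ?ls1 ?u ?v"
    using notin V1 by (auto simp: path_edge_def)
  have delete: "chrom_sym ?V1 (delete_edge (path_edge ?ls1) ?u ?v) \<eta>1 = chrom_sym ?V2 (path_edge ?ls2) \<eta>2"
  \<comment> \<open>Without its only edge \<open>?v\<close> is isolated and can be renamed to
    \<open>?v'\<close>.\<close>
  proof (rule chrom_sym_iso[where f = "\<lambda>p. if p = ?v then ?v' else p"])
    show "bij_betw (\<lambda>p. if p = ?v then ?v' else p) ?V1 ?V2"
      unfolding V1 V2 by (rule bij_betwI[where g = "\<lambda>p. if p = ?v' then ?v else p"]) (use notin in auto)
    show "\<eta>1 p = \<eta>2 (if p = ?v then ?v' else p)" if "p \<in> ?V1" for p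
      using that V1 notin by (auto simp: \<eta>1_def \<eta>2_def)
    fix p q assume pq: "p \<in> ?V1" "q \<in> ?V1"
    have "delete_edge (path_edge ?ls1) ?u ?v p q \<longleftrightarrow> p \<noteq> ?v \<and> q \<noteq> ?v \<and> path_edge ls p q"
      using pq ij j unfolding delete_edge_def path_edge_def V1
      by (auto simp: path_verts_def doubleton_eq_iff)
    also have "\<dots> \<longleftrightarrow> path_edge ?ls2 (if p = ?v then ?v' else p) (if q = ?v then ?v' else q)"
      using pq notin unfolding path_edge_def V1 V2 by (auto simp: path_verts_def)
    finally show "delete_edge (path_edge ?ls1) ?u ?v p q =
        path_edge ?ls2 (if p = ?v then ?v' else p) (if q = ?v then ?v' else q)" .
  qed
  have contract: "chrom_sym (?V1 - {?v}) (contract_edge (path_edge ?ls1) ?u ?v) (\<eta>1(?u := \<eta>1 ?u + \<eta>1 ?v))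
      = chrom_sym ?V (path_edge ls) \<omega>"
  proof -
    have "?V1 - {?v} = ?V" using V1 notin by auto
    moreover have "chrom_sym ?V (contract_edge (path_edge ?ls1) ?u ?v) (\<eta>1(?u := \<eta>1 ?u + \<eta>1 ?v))
      = chrom_sym ?V (path_edge ls) \<omega>"
    proof (rule chrom_sym_cong)
      show "(\<eta>1(?u := \<eta>1 ?u + \<eta>1 ?v)) p = \<omega> p" if "p \<in> ?V" for p
        using that notin ij by (auto simp: \<eta>1_def)
      fix p q assume pq: "p \<in> ?V" "q \<in> ?V"
      \<comment> \<open>As the end of its path, \<open>?v\<close> has only \<open>?u\<close> as
        neighbour, so the contraction creates no new edge.\<close>
      have nb: "q = ?u \<or> q = ?v" if "path_edge ?ls1 ?v q \<or> path_edge ?ls1 q ?v" for q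
        using that ij j unfolding path_edge_def V1 by (auto simp: path_verts_def)
      have old: "path_edge ?ls1 p q \<longleftrightarrow> path_edge ls p q" if "p \<noteq> ?v" "q \<noteq> ?v" for p q
        using that unfolding path_edge_def V1 by auto
      have loop: "\<not> path_edge ?ls1 p p" for p by (simp add: path_edge_def)
      show "contract_edge (path_edge ?ls1) ?u ?v p q \<longleftrightarrow> path_edge ls p q"
      proof
        assume "contract_edge (path_edge ?ls1) ?u ?v p q"
        then obtain p' q' where *: "p \<noteq> q" "path_edge ?ls1 p' q'"
            "merge_vertex ?u ?v p' = p" "merge_vertex ?u ?v q' = q"
          by (auto simp: contract_edge_def)
        have "p' \<noteq> ?v" using * nb[of q'] by (auto simp: merge_vertex_def)
        moreover have "q' \<noteq> ?v" using * nb[of p'] by (auto simp: merge_vertex_def)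
        ultimately show "path_edge ls p q" using * old by (simp add: merge_vertex_def)
      next
        assume R: "path_edge ls p q"
        have "p \<noteq> ?v" "q \<noteq> ?v" using pq notin by auto
        moreover have "p \<noteq> q" using R by (auto simp: path_edge_def)
        ultimately show "contract_edge (path_edge ?ls1) ?u ?v p q"
          using R old unfolding contract_edge_def merge_vertex_def by metis
      qed
    qed
    ultimately show ?thesis by simp
  qed
  have "chrom_sym ?V (path_edge ls) \<omega> =
      (\<lambda>\<alpha>. chrom_sym ?V2 (path_edge ?ls2) \<eta>2 \<alpha> - chrom_sym ?V1 (path_edge ?ls1) \<eta>1 \<alpha>)"
    using chrom_sym_deletion_contraction[OF simple_graph_path pos1 edge]
    unfolding delete contract by (simp add: fun_eq_iff)
  \<comment> \<open>The additional path of \<open>?ls2\<close> is a factor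
    \<open>x = (x - 1) + 1\<close>; the subtraction removes the summand 1 and leaves one more factor
    \<open>x - 1\<close>.\<close>
  moreover have "monom 1 (length ?ls2) * [:-1, 1:] ^ e - monom 1 (length ?ls1) * [:-1, 1:] ^ e
      = (monom 1 (length ls) * [:-1, 1:] ^ Suc e :: rat poly)"
  proof -
    have "monom 1 (length ?ls2) = monom 1 (length ls) * ([:-1, 1:] + 1 :: rat poly)"
      by (simp add: monom_Suc one_pCons)
    moreover have "m * (c + 1) * c ^ e - m * c ^ e = m * c ^ Suc e" for m c :: "rat poly"
      by (simp add: algebra_simps)
    ultimately show ?thesis unfolding length_list_update by (simp only:)
  qed
  ultimately show ?case using has_tau_diff[OF tau2 tau1] by simp
qed

lemma has_tau_edgeless:
  assumes "finite V" "\<forall>v\<in>V. 1 \<le> \<omega> v"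
  shows "has_tau (chrom_sym V (\<lambda>_ _. False) \<omega>)
    ([:-1, 1:] ^ ((\<Sum>v\<in>V. \<omega> v) - card V) * monom 1 (card V))"
proof -
  let ?ls = "replicate (card V) (1 :: nat)"
  obtain f where f: "bij_betw f {0..<card V} V" using ex_bij_betw_nat_finite assms(1) by blast
  have verts: "path_verts ?ls = {0..<card V} \<times> {0}" by (auto simp: path_verts_def)
  have bij: "bij_betw (f \<circ> fst) (path_verts ?ls) V"
    unfolding verts by (rule bij_betw_trans[OF _ f]) (auto simp: bij_betw_def inj_on_def)
  have iso: "chrom_sym (path_verts ?ls) (path_edge ?ls) (\<omega> \<circ> (f \<circ> fst)) = chrom_sym V (\<lambda>_ _. False) \<omega>"
    by (rule chrom_sym_iso[OF bij]) (auto simp: path_edge_def path_verts_def)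
  have sum: "(\<Sum>p\<in>path_verts ?ls. (\<omega> \<circ> (f \<circ> fst)) p) = (\<Sum>v\<in>V. \<omega> v)"
    using sum.reindex_bij_betw[OF bij, of \<omega>] by simp
  have "card V \<le> (\<Sum>v\<in>V. \<omega> v)" using sum_mono[of V "\<lambda>_. 1" \<omega>] assms(2) by simp
  moreover have "card (path_verts ?ls) = card V" unfolding verts by simp
  moreover have "f (fst p) \<in> V" if "p \<in> path_verts ?ls" for p
    using bij_betwE[OF bij] that by simp
  ultimately have "has_tau (chrom_sym (path_verts ?ls) (path_edge ?ls) (\<omega> \<circ> (f \<circ> fst)))
      (monom 1 (length ?ls) * [:-1, 1:] ^ ((\<Sum>v\<in>V. \<omega> v) - card V))"
    using assms(2) sum by (intro has_tau_path_forest) auto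
  then show ?thesis unfolding iso by (simp add: mult.commute)
qed

section \<open>Arbitrary graphs by induction on the edges\<close>

text \<open>The polynomial \<open>q\<close> is chosen before the weights. The induction relies on
  this, since contraction changes them, and weights 1 will identify \<open>q\<close> as the tree
  polynomial of the underlying graph.\<close>

lemma has_tau_chrom_sym:
  assumes "simple_graph V E"
  shows "\<exists>q. poly q 1 = 1 \<and> (\<forall>\<omega>. (\<forall>v\<in>V. 1 \<le> \<omega> v) \<longrightarrow>
    has_tau (chrom_sym V E \<omega>) ([:-1, 1:] ^ ((\<Sum>v\<in>V. \<omega> v) - card V) * q))"
  using assms
proof (induction "card {(a, b). E a b}" arbitrary: V E rule: less_induct)
  case less
  note G = less.prems
  have V: "finite V" using G by (simp add: simple_graph_def)
  have "{(a, b). E a b} \<subseteq> V \<times> V" using G by (auto simp: simple_graph_def)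
  then have finE: "finite {(a, b). E a b}" using V finite_subset by blast
  show ?case
  proof (cases "\<exists>u v. E u v")
    case False
    then have "E = (\<lambda>_ _. False)" by auto
    then show ?thesis
      using has_tau_edgeless[OF V] by (intro exI[of _ "monom 1 (card V)"]) (auto simp: poly_monom)
  next
    case True
    then obtain u v where e: "E u v" by blast
    have uv: "u \<in> V" "v \<in> V" "u \<noteq> v" using G e by (auto simp: simple_graph_def)
    let ?D = "delete_edge E u v" and ?C = "contract_edge E u v" and ?V = "V - {v}"
    have "{(a, b). ?D a b} \<subset> {(a, b). E a b}" using e by (auto simp: delete_edge_def)
    then have "card {(a, b). ?D a b} < card {(a, b). E a b}" using finE psubset_card_mono by blast
    from less.hyps[OF this simple_graph_delete_edge[OF G]] obtain q1 where q1: "poly q1 1 = 1"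
      "\<And>\<omega>. \<forall>v\<in>V. 1 \<le> \<omega> v \<Longrightarrow>
        has_tau (chrom_sym V ?D \<omega>) ([:-1, 1:] ^ ((\<Sum>v\<in>V. \<omega> v) - card V) * q1)"
      by blast
    let ?m = "map_prod (merge_vertex u v) (merge_vertex u v)"
    \<comment> \<open>Edges of the contraction are images of edges other than \<open>(u, v)\<close>;
      losing this one ordered pair gives the strict decrease.\<close>
    have "{(a, b). ?C a b} \<subseteq> ?m ` ({(a, b). E a b} - {(u, v)})"
    proof clarify
      fix a b assume "?C a b"
      then obtain a' b' where *: "a \<noteq> b" "E a' b'" "merge_vertex u v a' = a" "merge_vertex u v b' = b"
        by (auto simp: contract_edge_def)
      then have "(a', b') \<noteq> (u, v)" by (auto simp: merge_vertex_def)
      then have "(a', b') \<in> {(a, b). E a b} - {(u, v)}" using * by simp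
      moreover have "(a, b) = ?m (a', b')" using * by simp
      ultimately show "(a, b) \<in> ?m ` ({(a, b). E a b} - {(u, v)})" by (rule rev_image_eqI)
    qed
    then have "card {(a, b). ?C a b} \<le> card ({(a, b). E a b} - {(u, v)})"
      using finE by (meson card_image_le card_mono finite_Diff finite_imageI le_trans)
    also have "\<dots> < card {(a, b). E a b}" using finE e by (intro card_Diff1_less) auto
    finally have "card {(a, b). ?C a b} < card {(a, b). E a b}" .
    from less.hyps[OF this simple_graph_contract_edge[OF G uv(1,3)]] obtain q2 where q2:
      "\<And>\<omega>. \<forall>v\<in>?V. 1 \<le> \<omega> v \<Longrightarrow>
        has_tau (chrom_sym ?V ?C \<omega>) ([:-1, 1:] ^ ((\<Sum>v\<in>?V. \<omega> v) - card ?V) * q2)"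
      by blast
    have "has_tau (chrom_sym V E \<omega>) ([:-1, 1:] ^ ((\<Sum>v\<in>V. \<omega> v) - card V) * (q1 - [:-1, 1:] * q2))"
      if w: "\<forall>v\<in>V. 1 \<le> \<omega> v" for \<omega>
    proof -
      let ?w = "\<omega>(u := \<omega> u + \<omega> v)"
      \<comment> \<open>This bound makes the subtraction genuine: at equal total weight, one vertex
        less means excess one higher.\<close>
      have "card V \<le> (\<Sum>v\<in>V. \<omega> v)" using sum_mono[of V "\<lambda>_. 1" \<omega>] w by simp
      then have "(\<Sum>a\<in>?V. ?w a) - card ?V = Suc ((\<Sum>v\<in>V. \<omega> v) - card V)"
        using sum_merge_vertex[OF V uv, of \<omega>] card_Suc_Diff1[OF V uv(2)] by linarith
      moreover have w': "\<forall>a\<in>?V. 1 \<le> ?w a" using w uv by auto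
      ultimately have "has_tau (chrom_sym ?V ?C ?w) ([:-1, 1:] ^ Suc ((\<Sum>v\<in>V. \<omega> v) - card V) * q2)"
        using q2[OF w'] by (simp only:)
      note has_tau_diff[OF q1(2)[OF w] this]
      moreover have "chrom_sym V E \<omega> = (\<lambda>\<alpha>. chrom_sym V ?D \<omega> \<alpha> - chrom_sym ?V ?C ?w \<alpha>)"
        using chrom_sym_deletion_contraction[OF G w e] by (simp add: fun_eq_iff)
      moreover have "c ^ k * q1 - c ^ Suc k * q2 = c ^ k * (q1 - c * q2)" for c :: "rat poly" and k
        by (simp add: algebra_simps)
      ultimately show ?thesis by (simp only:)
    qed
    \<comment> \<open>The factor \<open>x - 1\<close> vanishes at 1, so the new polynomial has the
      same value there as \<open>q1\<close>.\<close>
    then show ?thesis using q1(1) by (intro exI[of _ "q1 - [:-1, 1:] * q2"]) auto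
  qed
qed

section \<open>The excess weight as the multiplicity of the root 1\<close>

theorem theorem4p1:
  fixes V :: "'v set" and E :: "'v \<Rightarrow> 'v \<Rightarrow> bool" and \<omega> :: "'v \<Rightarrow> nat"
  assumes "simple_graph V E"
    and "\<forall>v\<in>V. 1 \<le> \<omega> v"
  defines "n \<equiv> card V" and "N \<equiv> (\<Sum>v\<in>V. \<omega> v)"
  shows "tau (chrom_sym V E \<omega>) = [:-1, 1:] ^ (N - n) * tau (chrom_sym V E (\<lambda>_. 1))
    \<and> poly (tau (chrom_sym V E (\<lambda>_. 1))) 1 \<noteq> 0
    \<and> (GREATEST k. [:-1, 1:] ^ k dvd tau (chrom_sym V E \<omega>)) = N - n"
proof -
  obtain q where q: "poly q 1 = 1" and tau_q: "\<And>\<omega>. \<forall>v\<in>V. 1 \<le> \<omega> v \<Longrightarrow>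
      has_tau (chrom_sym V E \<omega>) ([:-1, 1:] ^ ((\<Sum>v\<in>V. \<omega> v) - card V) * q)"
    using has_tau_chrom_sym[OF assms(1)] by blast
  \<comment> \<open>For weights 1 the exponent is \<open>card V - card V = 0\<close>.\<close>
  have tau1: "tau (chrom_sym V E (\<lambda>_. 1)) = q"
    using tau_eq[OF tau_q[of "\<lambda>_. 1"]] by simp
  have tau: "tau (chrom_sym V E \<omega>) = [:-1, 1:] ^ (N - n) * q"
    using tau_eq[OF tau_q[OF assms(2)]] by (simp add: N_def n_def)
  \<comment> \<open>Cancelling \<open>N - n\<close> factors from a higher power would make
    \<open>x - 1\<close> divide \<open>q\<close>, against \<open>q\<close> having value 1 at 1. The
    bound also ensures that the greatest exponent exists.\<close>
  have "k \<le> N - n" if "[:-1, 1:] ^ k dvd [:-1, 1:] ^ (N - n) * q" for k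
  proof (rule ccontr)
    assume "\<not> k \<le> N - n"
    then have "[:-1, 1:] ^ Suc (N - n) dvd ([:-1, 1:] ^ k :: rat poly)"
      by (intro le_imp_power_dvd) simp
    then have "[:-1, 1:] ^ (N - n) * [:-1, 1:] dvd [:-1, 1:] ^ (N - n) * q"
      using dvd_trans[OF _ that] unfolding power_Suc2 by blast
    then have "[:-1, 1:] ^ (N - n) = (0 :: rat poly) \<or> [:-1, 1:] dvd q"
      unfolding dvd_mult_cancel_left .
    then have "[:-1, 1:] dvd q" unfolding power_eq_0_iff by simp
    then show False using q poly_eq_0_iff_dvd[of q 1] by simp
  qed
  then have "(GREATEST k. [:-1, 1:] ^ k dvd tau (chrom_sym V E \<omega>)) = N - n"
    unfolding tau by (intro Greatest_equality) auto
  then show ?thesis using tau tau1 q by simp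
qed

end
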